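(* Let $n\ge 1$, and let $m=(m_1,\dots,m_n)$ and $m'=(m'_1,\dots,m'_n)$ be integer $n$-tuples with $m_1\ge m_2\ge\cdots\ge m_n\ge 0$ and $m'_1\ge m'_2\ge\cdots\ge m'_n\ge 0$. Then $$2^{2n}\int_{\overline F}\sin^+_m(x)\,\sin^+_{m'}(x)\,dx=|G_m|\,\delta_{m,m'} .$$
   Context: $\sin^+_m(x):=\sum_{w\in S_n}\prod_{j=1}^n\sin\big(2\pi m_{w(j)}x_j\big)$ for $x\in\mathbb R^n$ (the permanent of the matrix $(\sin 2\pi m_ix_j)_{i,j}$), where $S_n$ is the symmetric group. $G_m\subset S_n$ is the subgroup of permutations leaving the $n$-tuple $m$ invariant and $|G_m|$ is its order. $\overline F=\{x\in\mathbb R^n:\ \tfrac12\ge x_1\ge x_2\ge\cdots\ge x_n\ge 0\}$, and $dx$ is the Euclidean (Lebesgue) measure.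
   Formalization: The case m = m' with m_n = 0 is excluded (m_n > 0 is assumed when m = m'): there sin^+_m vanishes identically, so the left side is 0 while |G_m| ≥ 1 (e.g. n = 1, m = m' = (0)); for m ≠ m' zero entries remain allowed. *)

theory Defs
  imports "HOL-Analysis.Analysis" "HOL-Combinatorics.Permutations"
begin

text \<open>
  An \<open>n\<close>-tuple over \<open>'a\<close> is an element of \<open>{1..n} \<rightarrow>\<^sub>E UNIV\<close>, i.e. a function on \<open>nat\<close> that is
  \<open>undefined\<close> outside \<open>{1..n}\<close>; so equality of tuples is equality of functions, and
  \<open>{1..n} \<rightarrow>\<^sub>E (UNIV :: real set)\<close> is the space of \<open>lebesgue_tuples n\<close>.
\<close>

definition lebesgue_tuples :: "nat \<Rightarrow> (nat \<Rightarrow> real) measure" where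
  "lebesgue_tuples n = PiM {1..n} (\<lambda>_. lborel)"

definition decreasing_nonneg :: "nat \<Rightarrow> (nat \<Rightarrow> 'a::linordered_idom) \<Rightarrow> bool" where
  "decreasing_nonneg n m \<longleftrightarrow> (\<forall>i\<in>{1..<n}. m i \<ge> m (Suc i)) \<and> m n \<ge> 0"

text \<open>If \<open>m i = 0\<close> for some \<open>i \<in> {1..n}\<close>, every summand below vanishes, so \<open>sin_plus n m = (\<lambda>_. 0)\<close>.\<close>

definition sin_plus :: "nat \<Rightarrow> (nat \<Rightarrow> int) \<Rightarrow> (nat \<Rightarrow> real) \<Rightarrow> real" where
  "sin_plus n m x =
     (\<Sum>w | w permutes {1..n}. \<Prod>j = 1..n. sin (2 * pi * of_int (m (w j)) * x j))"

definition tuple_stabilizer :: "nat \<Rightarrow> (nat \<Rightarrow> int) \<Rightarrow> (nat \<Rightarrow> nat) set" where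
  "tuple_stabilizer n m = {w. w permutes {1..n} \<and> m \<circ> w = m}"

definition closed_domain :: "nat \<Rightarrow> (nat \<Rightarrow> real) set" where
  "closed_domain n = {x \<in> {1..n} \<rightarrow>\<^sub>E UNIV. 1 / 2 \<ge> x 1 \<and> decreasing_nonneg n x}"

end

theory Submission
  imports Defs
begin

text \<open>
  The product of the two permanents is symmetric in the coordinates, so \<open>n!\<close> times its integral over
  the simplex is its integral over the cube \<open>[0, 1/2]\<^sup>n\<close>. Expanded over pairs \<open>(w, w')\<close> of
  permutations, the latter factors into one-dimensional integrals of products of sines, each
  \<open>1/4\<close> or \<open>0\<close>, so it is \<open>4\<^sup>-\<^sup>n\<close> times the number of pairs with \<open>m \<circ> w = m' \<circ> w'\<close>. Two decreasing
  tuples are rearrangements of each other only if they are equal, and for \<open>m = m'\<close> there are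
  \<open>|G\<^sub>m|\<close> choices of \<open>w'\<close> for each of the \<open>n!\<close> permutations \<open>w\<close>.
\<close>

section \<open>Decreasing rearrangements\<close>

lemma decreasing_nonnegD:
  fixes a :: "nat \<Rightarrow> 'a::linordered_idom"
  assumes "decreasing_nonneg n a" "1 \<le> i" "i \<le> j" "j \<le> n"
  shows "a j \<le> a i"
  using assms(3,4)
proof (induction j rule: dec_induct)
  case (step k)
  then have "a (Suc k) \<le> a k" using assms by (auto simp: decreasing_nonneg_def)
  with step show ?case by simp
qed simp

text \<open>A sorted list is determined by its multiset of entries, and permuting indices preserves
  that multiset. The value type is an arbitrary linear order because the lemma serves both real
  points and integer tuples.\<close>

lemma antimono_on_permuted_eq:
  fixes a b :: "nat \<Rightarrow> 'a::linorder"
  assumes a: "antimono_on {1..n} a" and b: "antimono_on {1..n} b"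
    and w: "w permutes {1..n}" and eq: "\<And>i. i \<in> {1..n} \<Longrightarrow> b i = a (w i)"
    and i: "i \<in> {1..n}"
  shows "a i = b i"
proof -
  \<comment> \<open>Reading the indices backwards turns an antitone function into an ascending list,
    as \<open>sorted\<close> requires.\<close>
  let ?l = "rev [1..<Suc n]"
  have srt: "sorted (map c ?l)" if "antimono_on {1..n} c" for c :: "nat \<Rightarrow> 'a"
    unfolding rev_map[symmetric] sorted_wrt_rev sorted_wrt_map
    using monotone_onD[OF that] by (auto simp: sorted_wrt_iff_nth_less nth_append)
  have ms: "mset ?l = mset_set {1..n}"
    by (metis atLeastLessThanSuc_atLeastAtMost mset_rev mset_upt)
  have "mset (map b ?l) = image_mset b (mset_set {1..n})" using ms by (metis mset_map)
  also have "\<dots> = image_mset (\<lambda>i. a (w i)) (mset_set {1..n})"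
    by (intro image_mset_cong) (use eq in auto)
  also have "\<dots> = image_mset a (image_mset w (mset_set {1..n}))"
    by (simp add: multiset.map_comp o_def)
  also have "image_mset w (mset_set {1..n}) = mset_set {1..n}"
    by (rule permutes_image_mset[OF w])
  also have "image_mset a (mset_set {1..n}) = mset (map a ?l)" using ms by (metis mset_map)
  finally have "map a ?l = map b ?l"
    by (metis properties_for_sort srt a b)
  then have "\<forall>j\<in>set ?l. a j = b j" by (simp only: map_eq_conv)
  moreover have "i \<in> set ?l" using i by auto
  ultimately show ?thesis by blast
qed

text \<open>Sorting the indices by the negated value yields a list without repetitions whose entries
  are the values of the wanted permutation.\<close>

lemma ex_permutes_decreasing:
  fixes x :: "nat \<Rightarrow> real"
  shows "\<exists>w. w permutes {1..n} \<and> (\<forall>i\<in>{1..<n}. x (w i) \<ge> x (w (Suc i)))"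
proof -
  define ys where "ys = sort_key (\<lambda>i. - x i) [1..<Suc n]"
  have len: "length ys = n" and dist: "distinct ys" and set: "set ys = {1..n}"
    unfolding ys_def by auto
  have srt: "sorted (map (\<lambda>i. - x i) ys)" unfolding ys_def by (rule sorted_sort_key)
  \<comment> \<open>List positions start at 0 and tuple indices at 1, hence the shift; outside
    \<open>{1..n}\<close> a permutation has to be the identity.\<close>
  define w where "w i = (if i \<in> {1..n} then ys ! (i - 1) else i)" for i
  have "bij_betw (\<lambda>i. i - 1) {1..n} {..<n}"
    by (rule bij_betw_byWitness[where f' = Suc]) auto
  moreover have "bij_betw ((!) ys) {..<n} {1..n}"
    using bij_betw_nth[OF dist] len set by auto
  ultimately have "bij_betw ((!) ys \<circ> (\<lambda>i. i - 1)) {1..n} {1..n}" by (rule bij_betw_trans)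
  then have "bij_betw w {1..n} {1..n}"
    by (rule iffD1[OF bij_betw_cong, rotated]) (auto simp: w_def)
  then have "w permutes {1..n}" by (rule bij_imp_permutes) (auto simp: w_def)
  moreover have "x (w i) \<ge> x (w (Suc i))" if "i \<in> {1..<n}" for i
    using sorted_nth_mono[OF srt, of "i - 1" i] that len by (auto simp: w_def)
  ultimately show ?thesis by blast
qed

text \<open>Inside the cube, sorting gives existence; two decreasing rearrangements agree as tuples,
  and distinct coordinates then force equal permutations. Outside the cube there are none, since
  every coordinate of a point of the simplex lies between its last and its first one.\<close>

lemma card_decreasing_rearrangements:
  assumes n: "n \<ge> 1" and x: "x \<in> {1..n} \<rightarrow>\<^sub>E UNIV" and inj: "inj_on x {1..n}"
  shows "card {w. w permutes {1..n} \<and> x \<circ> w \<in> closed_domain n}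
         = (if \<forall>i\<in>{1..n}. x i \<in> {0..1/2} then 1 else 0)"
proof (cases "\<forall>i\<in>{1..n}. x i \<in> {0..1/2}")
  case True
  obtain w where w: "w permutes {1..n}" and dec: "\<And>i. i \<in> {1..<n} \<Longrightarrow> x (w i) \<ge> x (w (Suc i))"
    using ex_permutes_decreasing[of n x] by blast
  have xw: "x \<circ> v \<in> {1..n} \<rightarrow>\<^sub>E UNIV" if "v permutes {1..n}" for v
    using x that by (auto simp: PiE_iff extensional_def permutes_not_in)
  have "x (w i) \<in> {0..1/2}" if "i \<in> {1..n}" for i
    using True that permutes_in_image[OF w] by blast
  from this[of 1] this[of n] have "x \<circ> w \<in> closed_domain n"
    using xw[OF w] dec n by (auto simp: closed_domain_def decreasing_nonneg_def)
  moreover have "v = w" if v: "v permutes {1..n}" and vd: "x \<circ> v \<in> closed_domain n" for v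
  proof
    fix i
    have anti: "antimono_on {1..n} (x \<circ> u)" if "x \<circ> u \<in> closed_domain n" for u
      using that decreasing_nonnegD[of n "x \<circ> u"]
      by (intro monotone_onI) (auto simp: closed_domain_def)
    have "(x \<circ> w) i = (x \<circ> v) i" if i: "i \<in> {1..n}"
    proof (rule antimono_on_permuted_eq[OF anti anti _ _ i])
      show "x \<circ> w \<in> closed_domain n" "x \<circ> v \<in> closed_domain n" by fact+
      show "inv w \<circ> v permutes {1..n}" using permutes_compose[OF v permutes_inv[OF w]] .
      show "(x \<circ> v) j = (x \<circ> w) ((inv w \<circ> v) j)" for j
        using permutes_inverses(1)[OF w] by simp
    qed
    then show "v i = w i"
      using inj permutes_in_image[OF v] permutes_in_image[OF w]
      by (cases "i \<in> {1..n}") (auto simp: permutes_not_in[OF v] permutes_not_in[OF w] dest: inj_onD)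
  qed
  ultimately have "{w. w permutes {1..n} \<and> x \<circ> w \<in> closed_domain n} = {w}" using w by blast
  then show ?thesis using True by simp
next
  case False
  have "x i \<in> {0..1/2}" if w: "w permutes {1..n}" and wd: "x \<circ> w \<in> closed_domain n" and i: "i \<in> {1..n}" for w i
  proof -
    define j where "j = inv w i"
    have j: "j \<in> {1..n}" "w j = i"
      unfolding j_def using permutes_in_image[OF permutes_inv[OF w]] i permutes_inverses(1)[OF w] by auto
    then show ?thesis
      using decreasing_nonnegD[of n "x \<circ> w" 1 j] decreasing_nonnegD[of n "x \<circ> w" j n] wd
      by (auto simp: closed_domain_def decreasing_nonneg_def)
  qed
  then have none: "{w. w permutes {1..n} \<and> x \<circ> w \<in> closed_domain n} = {}" using False by blast
  show ?thesis unfolding none using False by simp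
qed

section \<open>Symmetrization over the simplex\<close>

lemma space_lebesgue_tuples [simp]: "space (lebesgue_tuples n) = {1..n} \<rightarrow>\<^sub>E UNIV"
  by (simp add: lebesgue_tuples_def space_PiM)

interpretation lborel_product: product_sigma_finite "\<lambda>_::nat. lborel :: real measure"
  by standard

lemma measurable_lebesgue_tuples_component [measurable]:
  "i \<in> {1..n} \<Longrightarrow> (\<lambda>x. x i) \<in> borel_measurable (lebesgue_tuples n)"
  unfolding lebesgue_tuples_def
  using measurable_component_singleton[of i "{1..n}" "\<lambda>_. lborel :: real measure"] by simp

lemma measurable_permute_coordinates:
  assumes w: "w permutes {1..n}"
  shows "(\<lambda>x. x \<circ> w) \<in> lebesgue_tuples n \<rightarrow>\<^sub>M lebesgue_tuples n"
proof -
  have "(\<lambda>x. \<lambda>i\<in>{1..n}. x (w i)) \<in> lebesgue_tuples n \<rightarrow>\<^sub>M lebesgue_tuples n"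
    unfolding lebesgue_tuples_def
    by (intro measurable_restrict measurable_component_singleton)
       (simp only: permutes_in_image[OF w])
  \<comment> \<open>This uses that points of the space are \<open>undefined\<close> outside
    \<open>{1..n}\<close> and that \<open>w\<close> fixes all indices there.\<close>
  moreover have "x \<circ> w = (\<lambda>i\<in>{1..n}. x (w i))" if "x \<in> space (lebesgue_tuples n)" for x
    using that w by (auto simp: fun_eq_iff permutes_not_in PiE_iff extensional_def)
  ultimately show ?thesis by (rule iffD2[OF measurable_cong, rotated])
qed

text \<open>A product measure is determined by its values on boxes. All factors being equal,
  permuting the sides of a box does not change its measure.\<close>

lemma distr_permute_coordinates:
  assumes w: "w permutes {1..n}"
  shows "distr (lebesgue_tuples n) (lebesgue_tuples n) (\<lambda>x. x \<circ> w) = lebesgue_tuples n"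
proof -
  let ?M = "\<lambda>_::nat. lborel :: real measure"
  have "distr (lebesgue_tuples n) (lebesgue_tuples n) (\<lambda>x. x \<circ> w) = PiM {1..n} ?M"
  proof (rule lborel_product.PiM_eqI)
    fix A :: "nat \<Rightarrow> real set" assume A: "\<And>i. i \<in> {1..n} \<Longrightarrow> A i \<in> sets lborel"
    have v: "inv w permutes {1..n}" by (rule permutes_inv[OF w])
    have "emeasure (distr (lebesgue_tuples n) (lebesgue_tuples n) (\<lambda>x. x \<circ> w)) (Pi\<^sub>E {1..n} A)
        = emeasure (lebesgue_tuples n) ((\<lambda>x. x \<circ> w) -` Pi\<^sub>E {1..n} A \<inter> space (lebesgue_tuples n))"
      by (rule emeasure_distr[OF measurable_permute_coordinates[OF w]])
         (use A in \<open>auto simp: lebesgue_tuples_def intro!: sets_PiM_I_finite\<close>)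
    \<comment> \<open>Coordinate \<open>i\<close> of \<open>x\<close> stands at position
      \<open>inv w i\<close> of \<open>x \<circ> w\<close>, so it is constrained by
      \<open>A (inv w i)\<close>.\<close>
    also have "(\<lambda>x. x \<circ> w) -` Pi\<^sub>E {1..n} A \<inter> space (lebesgue_tuples n) = Pi\<^sub>E {1..n} (\<lambda>i. A (inv w i))"
    proof (intro set_eqI iffI)
      fix x assume x: "x \<in> (\<lambda>x. x \<circ> w) -` Pi\<^sub>E {1..n} A \<inter> space (lebesgue_tuples n)"
      have "x i \<in> A (inv w i)" if "i \<in> {1..n}" for i
      proof -
        have "inv w i \<in> {1..n}" using that permutes_in_image[OF v] by blast
        then have "x (w (inv w i)) \<in> A (inv w i)" using x by (auto simp: PiE_iff)
        then show ?thesis using permutes_inverses(1)[OF w] by simp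
      qed
      then show "x \<in> Pi\<^sub>E {1..n} (\<lambda>i. A (inv w i))" using x by (auto simp: PiE_iff)
    next
      fix x assume x: "x \<in> Pi\<^sub>E {1..n} (\<lambda>i. A (inv w i))"
      have "x (w i) \<in> A i" if "i \<in> {1..n}" for i
      proof -
        have "w i \<in> {1..n}" using that permutes_in_image[OF w] by blast
        then have "x (w i) \<in> A (inv w (w i))" using x by (auto simp: PiE_iff)
        then show ?thesis using permutes_inverses(2)[OF w] by simp
      qed
      then show "x \<in> (\<lambda>x. x \<circ> w) -` Pi\<^sub>E {1..n} A \<inter> space (lebesgue_tuples n)"
        using x w by (auto simp: PiE_iff extensional_def permutes_not_in)
    qed
    also have "emeasure (lebesgue_tuples n) \<dots> = (\<Prod>i\<in>{1..n}. emeasure lborel (A (inv w i)))"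
      unfolding lebesgue_tuples_def
      by (rule lborel_product.emeasure_PiM) (use A permutes_in_image[OF v] in auto)
    also have "\<dots> = (\<Prod>i\<in>{1..n}. emeasure lborel (A i))"
      using prod.permute[OF v, of "\<lambda>i. emeasure lborel (A i)"] by (simp add: o_def)
    finally show "emeasure (distr (lebesgue_tuples n) (lebesgue_tuples n) (\<lambda>x. x \<circ> w)) (Pi\<^sub>E {1..n} A)
        = (\<Prod>i\<in>{1..n}. emeasure lborel (A i))" .
  qed (auto simp: lebesgue_tuples_def)
  then show ?thesis by (simp add: lebesgue_tuples_def)
qed

text \<open>Each of the finitely many diagonals \<open>x i = x j\<close> is null by Fubini: with the
  other coordinates fixed, coordinate \<open>i\<close> is confined to one point.\<close>

lemma AE_lebesgue_tuples_inj_on: "AE x in lebesgue_tuples n. inj_on x {1..n}"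
proof -
  have "AE x in lebesgue_tuples n. x i \<noteq> x j" if i: "i \<in> {1..n}" and j: "j \<in> {1..n}" and "i \<noteq> j" for i j
  proof (rule AE_I)
    define S where "S = {x \<in> space (lebesgue_tuples n). x i = x j}"
    show S: "S \<in> sets (lebesgue_tuples n)" unfolding S_def using i j by measurable
    show "{x \<in> space (lebesgue_tuples n). \<not> x i \<noteq> x j} \<subseteq> S" by (auto simp: S_def)
    have ins: "insert i ({1..n} - {i}) = {1..n}" using i by auto
    have "emeasure (lebesgue_tuples n) S = (\<integral>\<^sup>+x. indicator S x \<partial>PiM (insert i ({1..n} - {i})) (\<lambda>_. lborel))"
      using S unfolding ins by (simp add: lebesgue_tuples_def)
    also have "\<dots> = (\<integral>\<^sup>+x. \<integral>\<^sup>+y. indicator S (x(i := y)) \<partial>lborel \<partial>PiM ({1..n} - {i}) (\<lambda>_. lborel))"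
      by (rule lborel_product.product_nn_integral_insert)
         (use S in \<open>unfold ins, auto simp: lebesgue_tuples_def\<close>)
    also have "\<dots> \<le> (\<integral>\<^sup>+x. 0 \<partial>PiM ({1..n} - {i}) (\<lambda>_. lborel :: real measure))"
    proof (rule nn_integral_mono)
      fix x :: "nat \<Rightarrow> real"
      \<comment> \<open>As \<open>i \<noteq> j\<close>, the update leaves \<open>x j\<close> alone,
        so the section of \<open>S\<close> lies in the singleton \<open>{x j}\<close>.\<close>
      have "(\<integral>\<^sup>+y. indicator S (x(i := y)) \<partial>lborel) \<le> (\<integral>\<^sup>+y. indicator {x j} y \<partial>lborel)"
        using \<open>i \<noteq> j\<close> by (intro nn_integral_mono) (auto simp: S_def split: split_indicator)
      then show "(\<integral>\<^sup>+y. indicator S (x(i := y)) \<partial>lborel) \<le> 0" by simp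
    qed
    finally show "emeasure (lebesgue_tuples n) S = 0" by simp
  qed
  then have "AE x in lebesgue_tuples n. \<forall>i\<in>{1..n}. \<forall>j\<in>{1..n}. i \<noteq> j \<longrightarrow> x i \<noteq> x j"
    by (auto intro!: AE_finite_allI)
  then show ?thesis by eventually_elim (auto simp: inj_on_def)
qed

lemma sets_closed_domain:
  assumes "n \<ge> 1"
  shows "closed_domain n \<in> sets (lebesgue_tuples n)"
proof -
  have ends: "1 \<in> {1..n}" "n \<in> {1..n}" using assms by auto
  have "closed_domain n = {x \<in> space (lebesgue_tuples n). (\<forall>i\<in>{1..<n}. x i \<ge> x (Suc i)) \<and>
      1 / 2 \<ge> x 1 \<and> x n \<ge> 0}"
    by (auto simp: closed_domain_def decreasing_nonneg_def)
  also have "\<dots> \<in> sets (lebesgue_tuples n)"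
  proof (intro sets.sets_Collect_conj sets.sets_Collect_finite_All)
    fix i assume "i \<in> {1..<n}"
    then have "i \<in> {1..n}" "Suc i \<in> {1..n}" by auto
    then show "{x \<in> space (lebesgue_tuples n). x i \<ge> x (Suc i)} \<in> sets (lebesgue_tuples n)"
      by (intro borel_measurable_le measurable_lebesgue_tuples_component)
  next
    show "{x \<in> space (lebesgue_tuples n). 1 / 2 \<ge> x 1} \<in> sets (lebesgue_tuples n)"
      "{x \<in> space (lebesgue_tuples n). x n \<ge> 0} \<in> sets (lebesgue_tuples n)"
      by (intro borel_measurable_le borel_measurable_const
          measurable_lebesgue_tuples_component ends)+
  qed simp
  finally show ?thesis .
qed

text \<open>Off the null set where two coordinates agree, exactly one rearrangement of a point of the
  cube \<open>[0, 1/2]\<^sup>n\<close> lies in the simplex.\<close>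

lemma integral_closed_domain_symmetric:
  fixes f :: "(nat \<Rightarrow> real) \<Rightarrow> real"
  defines "Q n \<equiv> {1..n} \<rightarrow>\<^sub>E {0..1/2::real}"
  assumes n: "n \<ge> 1"
    and sym: "\<And>w x. w permutes {1..n} \<Longrightarrow> f (x \<circ> w) = f x"
    and int: "integrable (lebesgue_tuples n) (\<lambda>x. indicator (Q n) x * f x)"
  shows "fact n * (LINT x:closed_domain n|lebesgue_tuples n. f x)
         = (LINT x|lebesgue_tuples n. indicator (Q n) x * f x)"
proof -
  let ?L = "lebesgue_tuples n" and ?P = "{w. w permutes {1..n}}"
  let ?F = "closed_domain n"
  have FQ: "?F \<subseteq> Q n"
  proof
    fix x assume x: "x \<in> ?F"
    have "x i \<in> {0..1/2}" if "i \<in> {1..n}" for i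
      using that x decreasing_nonnegD[of n x 1 i] decreasing_nonnegD[of n x i n]
      by (auto simp: closed_domain_def decreasing_nonneg_def)
    then show "x \<in> Q n" using x unfolding Q_def by (auto simp: closed_domain_def PiE_iff)
  qed
  have intF: "integrable ?L (\<lambda>x. indicator ?F x * f x)"
  proof -
    have "integrable ?L (\<lambda>x. indicator (Q n) x * f x * indicator ?F x)"
      by (rule integrable_real_mult_indicator[OF sets_closed_domain[OF n] int])
    also have "(\<lambda>x. indicator (Q n) x * f x * indicator ?F x) = (\<lambda>x. indicator ?F x * f x)"
      using FQ by (auto simp: fun_eq_iff split: split_indicator)
    finally show ?thesis .
  qed
  \<comment> \<open>Change of variables: the measure and \<open>f\<close> are both invariant under
    \<open>w\<close>, so each rearranged copy of the simplex contributes the same integral.\<close>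
  have step: "integrable ?L (\<lambda>x. indicator ?F (x \<circ> w) * f x) \<and>
      (LINT x|?L. indicator ?F (x \<circ> w) * f x) = (LINT x|?L. indicator ?F x * f x)"
    if w: "w permutes {1..n}" for w
  proof
    note T = measurable_permute_coordinates[OF w] and D = distr_permute_coordinates[OF w]
    note meas = borel_measurable_integrable[OF intF]
    have "integrable (distr ?L ?L (\<lambda>x. x \<circ> w)) (\<lambda>x. indicator ?F x * f x)" using intF D by simp
    from integrable_distr[OF T this] show "integrable ?L (\<lambda>x. indicator ?F (x \<circ> w) * f x)"
      by (simp add: sym[OF w])
    have "(LINT x|?L. indicator ?F x * f x) = (LINT x|distr ?L ?L (\<lambda>x. x \<circ> w). indicator ?F x * f x)"
      using D by simp
    also have "\<dots> = (LINT x|?L. indicator ?F (x \<circ> w) * f x)"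
      by (subst integral_distr[OF T meas]) (simp add: sym[OF w])
    finally show "(LINT x|?L. indicator ?F (x \<circ> w) * f x) = (LINT x|?L. indicator ?F x * f x)" ..
  qed
  have fin: "finite ?P" by (rule finite_permutations) simp
  have "fact n * (LINT x:?F|?L. f x) = (\<Sum>w\<in>?P. LINT x|?L. indicator ?F (x \<circ> w) * f x)"
    using step card_permutations[of "{1..n}" n] by (simp add: set_lebesgue_integral_def)
  also have "\<dots> = (LINT x|?L. (\<Sum>w\<in>?P. indicator ?F (x \<circ> w) * f x))"
    using step by (intro Bochner_Integration.integral_sum[symmetric]) auto
  also have "\<dots> = (LINT x|?L. indicator (Q n) x * f x)"
  proof (rule integral_cong_AE)
    show "(\<lambda>x. \<Sum>w\<in>?P. indicator ?F (x \<circ> w) * f x) \<in> borel_measurable ?L"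
      using step by (intro borel_measurable_sum borel_measurable_integrable) auto
    show "(\<lambda>x. indicator (Q n) x * f x) \<in> borel_measurable ?L"
      using int by (rule borel_measurable_integrable)
    show "AE x in ?L. (\<Sum>w\<in>?P. indicator ?F (x \<circ> w) * f x) = indicator (Q n) x * f x"
      using AE_lebesgue_tuples_inj_on AE_space
    proof eventually_elim
      case (elim x)
      have x: "x \<in> {1..n} \<rightarrow>\<^sub>E UNIV" using elim by simp
      \<comment> \<open>The indicators of the copies add up to the number of rearrangements of
        \<open>x\<close> in the simplex, which for distinct coordinates is the indicator of the
        cube.\<close>
      have "(\<Sum>w\<in>?P. indicator ?F (x \<circ> w)) = (\<Sum>w\<in>?P. if x \<circ> w \<in> ?F then 1 else 0 :: real)"
        by (simp add: indicator_def of_bool_def)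
      also have "\<dots> = real (card {w. w permutes {1..n} \<and> x \<circ> w \<in> ?F})"
        using fin by (simp add: sum.If_cases Int_def)
      also have "\<dots> = indicator (Q n) x"
        unfolding card_decreasing_rearrangements[OF n x elim(1)]
        using x by (auto simp: Q_def PiE_iff indicator_def)
      finally show ?case by (simp add: sum_distrib_right[symmetric])
    qed
  qed
  finally show ?thesis .
qed

section \<open>Orthogonality on the cube\<close>

text \<open>For \<open>k \<noteq> 0\<close> the antiderivative is a multiple of a sine that vanishes
  at both ends, its argument at 1/2 being \<open>pi * k\<close>.\<close>

lemma has_bochner_integral_cos_int:
  fixes k :: int
  shows "has_bochner_integral lborel (\<lambda>x. cos (2 * pi * of_int k * x) * indicator {0..1/2::real} x)
           (if k = 0 then 1/2 else 0)"
proof (cases "k = 0")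
  case True
  have "has_bochner_integral lborel (\<lambda>x. 1 * indicator {0..1/2::real} x) (1/2 - 0 :: real)"
    by (rule has_bochner_integral_FTC_Icc_real) (auto intro!: derivative_eq_intros)
  then show ?thesis using True by simp
next
  case False
  define F where "F x = sin (2 * pi * of_int k * x) / (2 * pi * of_int k)" for x :: real
  have "has_bochner_integral lborel (\<lambda>x. cos (2 * pi * of_int k * x) * indicator {0..1/2::real} x)
      (F (1/2) - F 0)"
    unfolding F_def using False
    by (intro has_bochner_integral_FTC_Icc_real) (auto intro!: derivative_eq_intros)
  moreover have "F (1/2) = 0" "F 0 = 0"
    using sin_npi_int[of k] by (simp_all add: F_def mult.commute)
  ultimately show ?thesis using False by simp
qed

text \<open>The product formula leaves cosines of frequencies \<open>a - b\<close> and
  \<open>a + b\<close>. For nonnegative \<open>a\<close> and \<open>b\<close> the second frequency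
  is zero only if both are, and then the two contributions cancel.\<close>

lemma has_bochner_integral_sin_sin_int:
  fixes a b :: int
  assumes "a \<ge> 0" "b \<ge> 0"
  shows "has_bochner_integral lborel
           (\<lambda>x. indicator {0..1/2::real} x * (sin (2 * pi * of_int a * x) * sin (2 * pi * of_int b * x)))
           (if a = b \<and> a \<noteq> 0 then 1/4 else 0)"
proof -
  let ?c = "\<lambda>k x. cos (2 * pi * of_int k * x) * indicator {0..1/2::real} x"
  have "has_bochner_integral lborel (\<lambda>x. 1/2 * (?c (a - b) x - ?c (a + b) x))
      (1/2 * ((if a - b = 0 then 1/2 else 0) - (if a + b = 0 then 1/2 else 0)))"
    by (intro has_bochner_integral_mult_right has_bochner_integral_diff has_bochner_integral_cos_int)
  also have "(\<lambda>x. 1/2 * (?c (a - b) x - ?c (a + b) x)) =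
      (\<lambda>x. indicator {0..1/2::real} x * (sin (2 * pi * of_int a * x) * sin (2 * pi * of_int b * x)))"
    by (auto simp: fun_eq_iff sin_times_sin algebra_simps)
  also have "1/2 * ((if a - b = 0 then 1/2 else 0) - (if a + b = 0 then 1/2 else 0))
      = (if a = b \<and> a \<noteq> 0 then 1/4 else 0 :: real)"
    using assms by auto
  finally show ?thesis .
qed

text \<open>A permanent is invariant under permuting columns: the permutation of the coordinates is
  absorbed by reindexing the sum over \<open>w\<close>.\<close>

lemma sin_plus_permute:
  assumes v: "v permutes {1..n}"
  shows "sin_plus n m (x \<circ> v) = sin_plus n m x"
proof -
  let ?P = "{w. w permutes {1..n}}"
  let ?s = "\<lambda>w x. \<Prod>j = 1..n. sin (2 * pi * of_int (m (w j)) * x j)"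
  have "sin_plus n m x = (\<Sum>w\<in>?P. ?s w x)" by (simp add: sin_plus_def)
  also have "\<dots> = (\<Sum>w\<in>?P. ?s (w \<circ> inv v) x)"
    by (rule sum_permutations_compose_right[OF permutes_inv[OF v]])
  also have "\<dots> = (\<Sum>w\<in>?P. ?s w (x \<circ> v))"
  proof (rule sum.cong[OF refl])
    fix w
    show "?s (w \<circ> inv v) x = ?s w (x \<circ> v)"
      \<comment> \<open>Substituting \<open>v j\<close> for \<open>j\<close> in the product cancels
        \<open>inv v\<close> and moves \<open>v\<close> onto the coordinates.\<close>
      using prod.permute[OF v, of "\<lambda>j. sin (2 * pi * of_int (m ((w \<circ> inv v) j)) * x j)"]
        permutes_inverses(2)[OF v] by (simp add: o_def)
  qed
  finally show ?thesis by (simp add: sin_plus_def)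
qed

text \<open>Expanding both permanents gives a finite sum of products of one-variable functions,
  which Fubini integrates factor by factor.\<close>

lemma has_bochner_integral_sin_plus_cube:
  assumes m: "\<And>i. i \<in> {1..n} \<Longrightarrow> m i \<ge> 0" and m': "\<And>i. i \<in> {1..n} \<Longrightarrow> m' i \<ge> 0"
  shows "has_bochner_integral (lebesgue_tuples n)
      (\<lambda>x. indicator ({1..n} \<rightarrow>\<^sub>E {0..1/2}) x * (sin_plus n m x * sin_plus n m' x))
      (\<Sum>w | w permutes {1..n}. \<Sum>w' | w' permutes {1..n}.
         \<Prod>j = 1..n. if m (w j) = m' (w' j) \<and> m (w j) \<noteq> 0 then 1/4 else 0)"
    (is "has_bochner_integral ?L ?f (\<Sum>w\<in>?P. \<Sum>w'\<in>?P. ?c w w')")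
proof -
  \<comment> \<open>Each factor carries its own share of the indicator of the cube, so that it is
    integrable over the whole line.\<close>
  define g :: "int \<Rightarrow> int \<Rightarrow> real \<Rightarrow> real" where
    "g a b x = indicator {0..1/2} x * (sin (2 * pi * of_int a * x) * sin (2 * pi * of_int b * x))"
    for a b x
  have gI: "has_bochner_integral lborel (g a b) (if a = b \<and> a \<noteq> 0 then 1/4 else 0)"
    if "a \<ge> 0" "b \<ge> 0" for a b
    using has_bochner_integral_sin_sin_int[OF that] unfolding g_def .
  have "has_bochner_integral ?L (\<lambda>x. \<Prod>j = 1..n. g (m (w j)) (m' (w' j)) (x j)) (?c w w')"
    if w: "w \<in> ?P" and w': "w' \<in> ?P" for w w'
  proof -
    have *: "has_bochner_integral lborel (g (m (w j)) (m' (w' j)))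
        (if m (w j) = m' (w' j) \<and> m (w j) \<noteq> 0 then 1/4 else 0)" if "j \<in> {1..n}" for j
      using that w w' by (intro gI m m') (simp_all only: permutes_in_image mem_Collect_eq)
    have "integrable ?L (\<lambda>x. \<Prod>j = 1..n. g (m (w j)) (m' (w' j)) (x j))"
      unfolding lebesgue_tuples_def
      by (intro lborel_product.product_integrable_prod) (use * has_bochner_integral_iff in auto)
    moreover have "(LINT x|?L. (\<Prod>j = 1..n. g (m (w j)) (m' (w' j)) (x j)))
        = (\<Prod>j = 1..n. integral\<^sup>L lborel (g (m (w j)) (m' (w' j))))"
      unfolding lebesgue_tuples_def
      by (intro lborel_product.product_integral_prod) (use * has_bochner_integral_iff in auto)
    moreover have "(\<Prod>j = 1..n. integral\<^sup>L lborel (g (m (w j)) (m' (w' j)))) = ?c w w'"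
      by (intro prod.cong refl) (use * has_bochner_integral_iff in blast)
    ultimately show ?thesis by (simp add: has_bochner_integral_iff)
  qed
  then have "has_bochner_integral ?L (\<lambda>x. \<Sum>w\<in>?P. \<Sum>w'\<in>?P. \<Prod>j = 1..n. g (m (w j)) (m' (w' j)) (x j))
      (\<Sum>w\<in>?P. \<Sum>w'\<in>?P. ?c w w')"
    by (intro has_bochner_integral_sum)
  also have "?this \<longleftrightarrow> ?thesis"
  proof (rule has_bochner_integral_cong[OF refl _ refl])
    fix x assume "x \<in> space ?L"
    then have ind: "indicator ({1..n} \<rightarrow>\<^sub>E {0..1/2}) x = (\<Prod>j = 1..n. indicator {0..1/2} (x j) :: real)"
      by (auto simp: indicator_def PiE_iff of_bool_def)
    show "(\<Sum>w\<in>?P. \<Sum>w'\<in>?P. \<Prod>j = 1..n. g (m (w j)) (m' (w' j)) (x j)) = ?f x"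
      unfolding sin_plus_def sum_product unfolding sum_distrib_left ind g_def prod.distrib ..
  qed
  finally show ?thesis .
qed

section \<open>Counting pairs of permutations that match the two tuples\<close>

text \<open>The matching condition makes \<open>m'\<close> the rearrangement of \<open>m\<close> by
  \<open>w \<circ> inv w'\<close>, and a decreasing rearrangement is unique.\<close>

lemma decreasing_nonneg_rearrangement_unique:
  fixes m m' :: "nat \<Rightarrow> int"
  assumes m: "m \<in> {1..n} \<rightarrow>\<^sub>E UNIV" "decreasing_nonneg n m"
    and m': "m' \<in> {1..n} \<rightarrow>\<^sub>E UNIV" "decreasing_nonneg n m'"
    and w: "w permutes {1..n}" and w': "w' permutes {1..n}"
    and eq: "\<And>j. j \<in> {1..n} \<Longrightarrow> m (w j) = m' (w' j)"
  shows "m = m'"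
proof
  fix i
  have "m i = m' i" if i: "i \<in> {1..n}"
  proof (rule antimono_on_permuted_eq[of n m m' "w \<circ> inv w'"])
    show "antimono_on {1..n} m" "antimono_on {1..n} m'"
      using decreasing_nonnegD[OF m(2)] decreasing_nonnegD[OF m'(2)]
      by (auto intro!: monotone_onI)
    show "w \<circ> inv w' permutes {1..n}" by (rule permutes_compose[OF permutes_inv[OF w'] w])
    show "m' j = m ((w \<circ> inv w') j)" if "j \<in> {1..n}" for j
    proof -
      have "inv w' j \<in> {1..n}" using permutes_in_image[OF permutes_inv[OF w']] that by blast
      from eq[OF this] show ?thesis using permutes_inverses(1)[OF w'] by simp
    qed
  qed (use i in auto)
  then show "m i = m' i" using m(1) m'(1) by (cases "i \<in> {1..n}") (auto simp: PiE_iff extensional_def)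
qed

text \<open>The set counted is the coset of the stabilizer formed by all \<open>u \<circ> w\<close>,
  so right translation by \<open>w\<close> is a bijection onto it.\<close>

lemma card_rearrangements_eq:
  assumes m: "m \<in> {1..n} \<rightarrow>\<^sub>E UNIV" and w: "w permutes {1..n}"
  shows "card {w'. w' permutes {1..n} \<and> (\<forall>j\<in>{1..n}. m (w j) = m (w' j))} = card (tuple_stabilizer n m)"
proof (rule bij_betw_same_card[symmetric], rule bij_betw_byWitness[where f' = "\<lambda>v. v \<circ> inv w"])
  show "\<forall>u\<in>tuple_stabilizer n m. (u \<circ> w) \<circ> inv w = u"
    using permutes_inverses(1)[OF w] by (auto simp: fun_eq_iff)
  show "\<forall>v\<in>{w'. w' permutes {1..n} \<and> (\<forall>j\<in>{1..n}. m (w j) = m (w' j))}. (v \<circ> inv w) \<circ> w = v"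
    using permutes_inverses(2)[OF w] by (auto simp: fun_eq_iff)
  show "(\<lambda>u. u \<circ> w) ` tuple_stabilizer n m
      \<subseteq> {w'. w' permutes {1..n} \<and> (\<forall>j\<in>{1..n}. m (w j) = m (w' j))}"
    using permutes_compose[OF w] by (auto simp: tuple_stabilizer_def fun_eq_iff)
  show "(\<lambda>v. v \<circ> inv w) ` {w'. w' permutes {1..n} \<and> (\<forall>j\<in>{1..n}. m (w j) = m (w' j))}
      \<subseteq> tuple_stabilizer n m"
  proof safe
    fix v assume v: "v permutes {1..n}" and eq: "\<forall>j\<in>{1..n}. m (w j) = m (v j)"
    \<comment> \<open>All \<open>i\<close> are considered, since the stabilizer asks for equality of
      functions; outside \<open>{1..n}\<close> both permutations are the identity.\<close>
    have "m (v (inv w i)) = m i" for i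
    proof (cases "i \<in> {1..n}")
      case True
      then have "inv w i \<in> {1..n}" using permutes_in_image[OF permutes_inv[OF w]] by blast
      with eq have "m (v (inv w i)) = m (w (inv w i))" by simp
      then show ?thesis using permutes_inverses(1)[OF w] by simp
    qed (use v permutes_inv[OF w] in \<open>simp add: permutes_not_in\<close>)
    then show "v \<circ> inv w \<in> tuple_stabilizer n m"
      using permutes_compose[OF permutes_inv[OF w] v] by (auto simp: tuple_stabilizer_def fun_eq_iff)
  qed
qed

text \<open>The last assumption excludes \<open>m = m'\<close> with \<open>m n = 0\<close>. In that
  case every summand of \<open>sin_plus n m\<close> has a factor \<open>sin 0\<close>, so the left
  side is 0, while the stabilizer contains the identity and the right side is at least 1. For
  distinct tuples zero entries are allowed.\<close>

theorem mainTheorem3: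
  fixes n :: nat and m m' :: "nat \<Rightarrow> int"
  assumes "n \<ge> 1"
    and "m \<in> {1..n} \<rightarrow>\<^sub>E UNIV" and "m' \<in> {1..n} \<rightarrow>\<^sub>E UNIV"
    and "decreasing_nonneg n m" and "decreasing_nonneg n m'"
    and "m = m' \<Longrightarrow> m n > 0"
  shows "2 ^ (2 * n) * (LINT x:closed_domain n|lebesgue_tuples n. sin_plus n m x * sin_plus n m' x)
         = real (card (tuple_stabilizer n m)) * (if m = m' then 1 else 0)"
proof -
  let ?P = "{w. w permutes {1..n}}"
  let ?I = "LINT x:closed_domain n|lebesgue_tuples n. sin_plus n m x * sin_plus n m' x"
  let ?E = "\<lambda>w. {w'. w' permutes {1..n} \<and> (\<forall>j\<in>{1..n}. m (w j) = m' (w' j))}"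
  let ?c = "\<lambda>w w'. \<Prod>j = 1..n. if m (w j) = m' (w' j) \<and> m (w j) \<noteq> 0 then 1/4 else 0 :: real"
  have fin: "finite ?P" by (rule finite_permutations) simp
  have nonneg: "m i \<ge> 0" "m' i \<ge> 0" if "i \<in> {1..n}" for i
    using that decreasing_nonnegD[OF assms(4), of i n] decreasing_nonnegD[OF assms(5), of i n]
      assms(4,5) by (auto simp: decreasing_nonneg_def)
  note cube = has_bochner_integral_sin_plus_cube[of n m m', OF nonneg]
  have c: "?c w w' = (if w' \<in> ?E w then (1/4) ^ n else 0)" if w: "w \<in> ?P" and w': "w' \<in> ?P" for w w'
  proof (cases "w' \<in> ?E w")
    case True
    then have "m = m'"
      by (intro decreasing_nonneg_rearrangement_unique[OF assms(2,4,3,5), of w w']) (use w in auto)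
    \<comment> \<open>A matching pair forces \<open>m = m'\<close>; then the smallest entry
      \<open>m n\<close> is positive, so no factor is lost to frequency zero.\<close>
    have "m (w j) \<noteq> 0" if "j \<in> {1..n}" for j
    proof -
      have "w j \<in> {1..n}" using permutes_in_image[of w "{1..n}" j] w that by blast
      then have "m n \<le> m (w j)" by (intro decreasing_nonnegD[OF assms(4)]) simp_all
      then show ?thesis using assms(6)[OF \<open>m = m'\<close>] by simp
    qed
    then have "?c w w' = (\<Prod>j = 1..n. 1/4)" using True by (intro prod.cong) auto
    then show ?thesis using True by simp
  next
    case False
    then show ?thesis using w' by (auto simp: prod_zero_iff)
  qed
  \<comment> \<open>Both sides are the integral over the cube: the left by symmetrization, the right
    by expansion.\<close>
  have "fact n * ?I = (\<Sum>w\<in>?P. \<Sum>w'\<in>?P. ?c w w')"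
    using integral_closed_domain_symmetric[OF assms(1), of "\<lambda>x. sin_plus n m x * sin_plus n m' x"]
      cube by (simp add: sin_plus_permute has_bochner_integral_iff)
  also have "\<dots> = (\<Sum>w\<in>?P. \<Sum>w'\<in>?P. if w' \<in> ?E w then (1/4) ^ n else 0)"
    by (intro sum.cong refl c)
  also have "\<dots> = (\<Sum>w\<in>?P. real (card (?E w)) * (1/4) ^ n)"
  proof (rule sum.cong[OF refl])
    fix w
    have "?P \<inter> ?E w = ?E w" by blast
    then have "(\<Sum>w'\<in>?P. if w' \<in> ?E w then (1/4) ^ n else 0) = (\<Sum>w'\<in>?E w. (1/4) ^ n :: real)"
      using sum.inter_restrict[OF fin, of "\<lambda>_. (1/4) ^ n :: real" "?E w"] by (simp only:)
    then show "(\<Sum>w'\<in>?P. if w' \<in> ?E w then (1/4) ^ n else 0) = real (card (?E w)) * (1/4) ^ n"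
      by (simp only: sum_constant)
  qed
  also have "\<dots> = (\<Sum>w\<in>?P. real (card (tuple_stabilizer n m)) * (if m = m' then 1 else 0) * (1/4) ^ n)"
  proof (rule sum.cong[OF refl])
    fix w assume w: "w \<in> ?P"
    show "real (card (?E w)) * (1/4) ^ n
        = real (card (tuple_stabilizer n m)) * (if m = m' then 1 else 0) * (1/4) ^ n"
    proof (cases "m = m'")
      case True
      then show ?thesis using card_rearrangements_eq[OF assms(2), of w] w by simp
    next
      case False
      have "w' \<notin> ?E w" for w'
        using decreasing_nonneg_rearrangement_unique[OF assms(2,4,3,5), of w w'] w False by auto
      then have "?E w = {}" by (simp only: set_eq_iff empty_iff not_False_eq_True simp_thms)
      then have "card (?E w) = 0" by (simp only: card.empty)
      then show ?thesis using False by simp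
    qed
  qed
  also have "\<dots> = fact n * (real (card (tuple_stabilizer n m)) * (if m = m' then 1 else 0) * (1/4) ^ n)"
    using card_permutations[of "{1..n}" n] by simp
  finally have "?I = real (card (tuple_stabilizer n m)) * (if m = m' then 1 else 0) * (1/4) ^ n"
    by (simp only: mult_cancel_left fact_nonzero simp_thms)
  \<comment> \<open>The factor \<open>2 ^ (2 * n)\<close> is \<open>4 ^ n\<close>, which cancels
    \<open>(1/4) ^ n\<close>.\<close>
  then show ?thesis by (simp add: power_mult power_one_over)
qed

end
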